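(* For all integers $k\geq 3$, $r\geq 1$ and every real $\mu\in(0,\frac{k-1}{k})$ there exist a dimension $n$ and a set of points $\mathcal{X}\subseteq[k]^n$ such that (i) for every colouring of $\mathcal{X}$ with $r$ colours there is a monochromatic combinatorial line contained in $\mathcal{X}$, and (ii) every $\mathcal{Y}\subseteq\mathcal{X}$ contains a subset $\mathcal{Z}\subseteq\mathcal{Y}$ of size $|\mathcal{Z}|\geq\mu|\mathcal{Y}|$ such that $\mathcal{Z}$ contains no quasiline.
   Context: $[k]=\{1,\dots,k\}$ and $[k]^n$ is the $n$-dimensional Hales–Jewett cube. A combinatorial line in $[k]^n$ is a set of the form $\{\eta(i)\colon i\in[k]\}$ where, for some partition $[n]=C\cup M$ with $C\cap M=\emptyset$ and $M\neq\emptyset$ and some values $u_c\in[k]$ ($c\in C$), the point $\eta(i)$ has $c$-th coordinate $u_c$ for $c\in C$ and $m$-th coordinate $i$ for $m\in M$. A quasiline in $[k]^n$ is a $k$-element subset $L\subseteq[k]^n$ such that for every coordinate $\nu\in[n]$ the $\nu$-th entries of the points of $L$ are either all identical or mutually distinct. *)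

theory Defs
  imports Complex_Main "HOL-Library.FuncSet"
begin

definition cube :: "nat \<Rightarrow> nat \<Rightarrow> (nat \<Rightarrow> nat) set" where
  "cube k n = ({0..<n} \<rightarrow>\<^sub>E {1..k})"

definition comb_line :: "nat \<Rightarrow> nat \<Rightarrow> (nat \<Rightarrow> nat) set \<Rightarrow> bool" where
  "comb_line k n L \<longleftrightarrow>
     (\<exists>M u. M \<subseteq> {0..<n} \<and> M \<noteq> {} \<and> (\<forall>c\<in>{0..<n} - M. u c \<in> {1..k}) \<and>
        L = (\<lambda>i. restrict (\<lambda>c. if c \<in> M then i else u c) {0..<n}) ` {1..k})"

definition quasiline :: "nat \<Rightarrow> nat \<Rightarrow> (nat \<Rightarrow> nat) set \<Rightarrow> bool" where
  "quasiline k n L \<longleftrightarrow>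
     L \<subseteq> cube k n \<and> card L = k \<and>
     (\<forall>\<nu>\<in>{0..<n}. (\<forall>x\<in>L. \<forall>y\<in>L. x \<nu> = y \<nu>) \<or> inj_on (\<lambda>x. x \<nu>) L)"

end

theory Submission
  imports Defs "HOL-Library.Nat_Bijection" "HOL-Library.Ramsey"
begin

text \<open>
  Let \<open>H\<^sub>0\<close> be the \<open>k\<close>-uniform hypergraph on the \<open>m\<close>-element subsets of \<open>{..<N}\<close> whose edges consist of
  \<open>k\<close> consecutive windows of length \<open>m\<close> of an increasing sequence. By Ramsey's theorem it is not
  \<open>r\<close>-colourable for large \<open>N\<close>. Mark every number independently with a small probability and discard
  a window if it contains no marker, if it ends in a marker, or if its distance from the last
  marker lies in a random residue class modulo \<open>k\<close>. Each window is discarded with probability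
  close to \<open>1/k\<close>, and no edge survives.

  It remains to find a Ramsey set in a cube all of whose quasilines project to edges of \<open>H\<^sub>0\<close>.
  The partite construction, with the Hales-Jewett theorem as partite lemma, transforms a
  non-\<open>r\<close>-colourable hypergraph into points and selected combinatorial lines of a cube which still
  have the Ramsey property, and it projects the selected lines to edges. A first application to
  \<open>H\<^sub>0\<close> yields such a line system \<open>H\<^sub>1\<close>. In a second application, to \<open>H\<^sub>1\<close>, the vertices are points of
  a cube themselves, and their coordinates are added to those of the new points. Because \<open>k \<ge> 3\<close>,
  these additional coordinates force every quasiline to project to an edge of \<open>H\<^sub>1\<close>.
\<close>

section \<open>The Hales-Jewett theorem\<close>

definition words :: "'a set \<Rightarrow> nat \<Rightarrow> 'a list set" where
  "words A d = {w. set w \<subseteq> A \<and> length w = d}"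

text \<open>\<open>None\<close> is the wildcard; filling it with all letters yields a combinatorial line.\<close>

definition var_words :: "'a set \<Rightarrow> nat \<Rightarrow> 'a option list set" where
  "var_words A d = {w. None \<in> set w \<and> set w \<subseteq> insert None (Some ` A) \<and> length w = d}"

definition fill :: "'a \<Rightarrow> 'a option list \<Rightarrow> 'a list" where
  "fill a w = map (case_option a id) w"

lemma finite_words: "finite A \<Longrightarrow> finite (words A d)"
  unfolding words_def by (rule finite_lists_length_eq)

lemma finite_var_words: "finite A \<Longrightarrow> finite (var_words A d)"
  by (rule finite_subset[OF _ finite_words[of "insert None (Some ` A)" d]])
    (auto simp: var_words_def words_def)

lemma fill_append [simp]: "fill a (v @ w) = fill a v @ fill a w"
  by (simp add: fill_def)

lemma fill_map_Some [simp]: "fill a (map Some w) = w"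
  by (simp add: fill_def o_def)

lemma length_fill [simp]: "length (fill a w) = length w"
  by (simp add: fill_def)

lemma nth_fill: "j < length w \<Longrightarrow> fill a w ! j = case_option a id (w ! j)"
  by (simp add: fill_def)

lemma set_fill_subset: "w \<in> var_words A d \<Longrightarrow> set (fill a w) \<subseteq> insert a A"
  by (force simp: var_words_def fill_def split: option.split)

lemma fill_in_words: "w \<in> var_words A d \<Longrightarrow> a \<in> A \<Longrightarrow> fill a w \<in> words A d"
  using set_fill_subset[of w A d a] by (auto simp: words_def var_words_def)

lemma mem_set_fill: "w \<in> var_words A d \<Longrightarrow> a \<in> set (fill a w)"
  by (force simp: var_words_def fill_def)

definition has_mono_line :: "'a set \<Rightarrow> nat \<Rightarrow> nat \<Rightarrow> ('a list \<Rightarrow> nat) \<Rightarrow> bool" where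
  "has_mono_line A d r c \<longleftrightarrow>
     (\<exists>w \<in> var_words A d. \<exists>q<r. \<forall>a\<in>A. c (fill a w) = q)"

text \<open>The focusing argument colours words by whole colourings of the remaining coordinates, so
  colours have to range over an arbitrary finite set.\<close>

lemma hales_jewett_finite_range:
  fixes C :: "'c set"
  assumes HJ: "\<And>r. r \<ge> 1 \<Longrightarrow> \<exists>d. \<forall>c. c ` words A d \<subseteq> {..<r} \<longrightarrow> has_mono_line A d r c"
    and C: "finite C"
  shows "\<exists>d. \<forall>c. c ` words A d \<subseteq> C \<longrightarrow>
           (\<exists>w \<in> var_words A d. \<exists>q. \<forall>a\<in>A. c (fill a w) = q)"
proof -
  \<comment> \<open>One spare colour keeps the number of colours positive when \<open>C\<close> is
    empty.\<close>
  obtain d where d: "\<And>c. c ` words A d \<subseteq> {..<Suc (card C)} \<Longrightarrow> has_mono_line A d (Suc (card C)) c"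
    using HJ[of "Suc (card C)"] by auto
  obtain h where h: "bij_betw h C {0..<card C}"
    using ex_bij_betw_finite_nat[OF C] by blast
  have "\<exists>w \<in> var_words A d. \<exists>q. \<forall>a\<in>A. c (fill a w) = q" if c: "c ` words A d \<subseteq> C" for c
  proof -
    have "(h \<circ> c) ` words A d \<subseteq> {..<Suc (card C)}"
    proof (rule image_subsetI)
      fix x assume "x \<in> words A d"
      then have "h (c x) \<in> {0..<card C}" using c bij_betwE[OF h] by blast
      then show "(h \<circ> c) x \<in> {..<Suc (card C)}" by simp
    qed
    then obtain w q where w: "w \<in> var_words A d" and q: "\<forall>a\<in>A. h (c (fill a w)) = q"
      using d[of "h \<circ> c"] unfolding has_mono_line_def by auto
    have "c (fill a w) \<in> C" if "a \<in> A" for a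
      using c fill_in_words[OF w that] by blast
    then have "c (fill a w) = inv_into C h q" if "a \<in> A" for a
      using q that bij_betw_inv_into_left[OF h] by force
    then show ?thesis using w by blast
  qed
  then show ?thesis by blast
qed

text \<open>The lines witnessing \<open>focused b A d c S z\<close> share the point \<open>z\<close>, and become
  monochromatic in the colours from \<open>S\<close> when this point is removed.\<close>

definition focused :: "'a \<Rightarrow> 'a set \<Rightarrow> nat \<Rightarrow> ('a list \<Rightarrow> nat) \<Rightarrow> nat set \<Rightarrow> 'a list \<Rightarrow> bool" where
  "focused b A d c S z \<longleftrightarrow> z \<in> words (insert b A) d \<and>
     (\<forall>q\<in>S. \<exists>w\<in>var_words (insert b A) d. fill b w = z \<and> (\<forall>a\<in>A. c (fill a w) = q))"

text \<open>Induction on the number \<open>s\<close> of focused lines. A block of \<open>D\<close>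
  letters goes in front, and Hales-Jewett over \<open>A\<close> is applied to it, the colour of a
  prefix being the colouring it induces on the words of length \<open>d\<close>. Along the resulting
  \<open>W\<close>, old lines extend diagonally to \<open>W @ w\<close>, and
  \<open>W @ map Some z\<close> adds the colour \<open>?q\<close> of the old focus. If
  \<open>?q\<close> was already present, the corresponding old line is monochromatic together with
  its focus.\<close>

lemma colour_focusing:
  assumes A: "finite A" "a0 \<in> A"
    and HJ: "\<And>r. r \<ge> 1 \<Longrightarrow> \<exists>d. \<forall>c. c ` words A d \<subseteq> {..<r} \<longrightarrow> has_mono_line A d r c"
  shows "\<exists>d. \<forall>c. c ` words (insert b A) d \<subseteq> {..<r} \<longrightarrow>
     has_mono_line (insert b A) d r c \<or> (\<exists>S\<subseteq>{..<r}. card S = s \<and> (\<exists>z. focused b A d c S z))"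
proof (induction s)
  case 0
  have "focused b A 0 c {} []" for c by (simp add: focused_def words_def)
  then show ?case by (metis card.empty empty_subsetI)
next
  case (Suc s)
  let ?A = "insert b A"
  obtain d where d: "\<And>c. c ` words ?A d \<subseteq> {..<r} \<Longrightarrow> has_mono_line ?A d r c \<or>
     (\<exists>S\<subseteq>{..<r}. card S = s \<and> (\<exists>z. focused b A d c S z))"
    using Suc.IH by blast
  let ?C = "words ?A d \<rightarrow>\<^sub>E {..<r}"
  have "finite ?C" using A by (intro finite_PiE finite_words) auto
  then obtain D where D: "\<And>c. c ` words A D \<subseteq> ?C \<Longrightarrow>
      \<exists>w \<in> var_words A D. \<exists>q. \<forall>a\<in>A. c (fill a w) = q"
    using hales_jewett_finite_range[OF HJ, where C = ?C] by blast
  show ?case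
  proof (intro exI[of _ "D + d"] allI impI)
    fix c assume c: "c ` words ?A (D + d) \<subseteq> {..<r}"
    have app: "x @ y \<in> words ?A (D + d)" if "x \<in> words ?A D" "y \<in> words ?A d" for x y
      using that by (auto simp: words_def)
    have AD: "words A D \<subseteq> words ?A D" by (auto simp: words_def)
    have "(\<lambda>x. restrict (\<lambda>y. c (x @ y)) (words ?A d)) ` words A D \<subseteq> ?C"
    proof (rule image_subsetI)
      fix x assume "x \<in> words A D"
      then have "c (x @ y) \<in> {..<r}" if "y \<in> words ?A d" for y
        using c app[OF _ that] AD by blast
      then show "restrict (\<lambda>y. c (x @ y)) (words ?A d) \<in> ?C" by simp
    qed
    from D[OF this] obtain W g where W: "W \<in> var_words A D"
      and g: "\<And>a. a \<in> A \<Longrightarrow> restrict (\<lambda>y. c (fill a W @ y)) (words ?A d) = g"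
      by blast
    \<comment> \<open>Prefixes filled with letters of \<open>A\<close> are interchangeable; nothing
      is known about \<open>fill b W\<close>, which therefore occurs only in the new focus.\<close>
    have same: "c (fill a W @ y) = c (fill a0 W @ y)" if "a \<in> A" "y \<in> words ?A d" for a y
      using fun_cong[OF trans[OF g[OF that(1)] g[OF A(2), symmetric]], of y] that(2) by simp
    have W': "W \<in> var_words ?A D" using W by (auto simp: var_words_def)
    let ?x = "fill a0 W"
    have x: "?x \<in> words ?A D" using fill_in_words[OF W A(2)] AD by blast
    have pre: "map Some ?x @ w \<in> var_words ?A (D + d)" if "w \<in> var_words ?A d" for w
      using that x by (auto simp: var_words_def words_def)
    have "(\<lambda>y. c (?x @ y)) ` words ?A d \<subseteq> {..<r}" using c app[OF x] by blast
    from d[OF this] show "has_mono_line ?A (D + d) r c \<or>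
     (\<exists>S\<subseteq>{..<r}. card S = Suc s \<and> (\<exists>z. focused b A (D + d) c S z))"
    proof
      assume "has_mono_line ?A d r (\<lambda>y. c (?x @ y))"
      then obtain w q where "w \<in> var_words ?A d" "q < r" "\<forall>a\<in>?A. c (?x @ fill a w) = q"
        unfolding has_mono_line_def by blast
      then have "has_mono_line ?A (D + d) r c"
        unfolding has_mono_line_def
        by (intro bexI[of _ "map Some ?x @ w"] exI[of _ q]) (auto intro: pre)
      then show ?thesis ..
    next
      assume "\<exists>S\<subseteq>{..<r}. card S = s \<and> (\<exists>z. focused b A d (\<lambda>y. c (?x @ y)) S z)"
      then obtain S z where S: "S \<subseteq> {..<r}" "card S = s"
        and foc: "focused b A d (\<lambda>y. c (?x @ y)) S z"
        by blast
      have z: "z \<in> words ?A d" using foc by (simp add: focused_def)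
      let ?q = "c (?x @ z)"
      have qr: "?q < r" using c app[OF x z] by blast
      show ?thesis
      proof (cases "?q \<in> S")
        case True
        then obtain w where "w \<in> var_words ?A d" "fill b w = z" "\<forall>a\<in>A. c (?x @ fill a w) = ?q"
          using foc unfolding focused_def by blast
        then have "has_mono_line ?A (D + d) r c"
          unfolding has_mono_line_def using qr
          by (intro bexI[of _ "map Some ?x @ w"] exI[of _ ?q]) (auto intro: pre)
        then show ?thesis ..
      next
        case False
        have "\<exists>w\<in>var_words ?A (D + d). fill b w = fill b W @ z \<and> (\<forall>a\<in>A. c (fill a w) = q)"
          if q: "q \<in> insert ?q S" for q
        proof (cases "q = ?q")
          case True
          have "W @ map Some z \<in> var_words ?A (D + d)"
            using W' z by (auto simp: var_words_def words_def)
          moreover have "c (fill a (W @ map Some z)) = q" if "a \<in> A" for a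
            using True same[OF that z] by simp
          ultimately show ?thesis by (intro bexI[of _ "W @ map Some z"]) auto
        next
          case False
          then obtain w where w: "w \<in> var_words ?A d" "fill b w = z"
            "\<forall>a\<in>A. c (?x @ fill a w) = q"
            using foc q unfolding focused_def by blast
          have "W @ w \<in> var_words ?A (D + d)" using W' w(1) by (auto simp: var_words_def)
          moreover have "c (fill a (W @ w)) = q" if a: "a \<in> A" for a
          proof -
            have "fill a w \<in> words ?A d" using fill_in_words[OF w(1)] a by blast
            then show ?thesis using same[OF a] w(3) a by simp
          qed
          ultimately show ?thesis using w(2) by (intro bexI[of _ "W @ w"]) auto
        qed
        moreover have "fill b W @ z \<in> words ?A (D + d)"
          using app[OF fill_in_words[OF W'] z] by blast
        ultimately have "focused b A (D + d) c (insert ?q S) (fill b W @ z)"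
          unfolding focused_def by blast
        moreover have "card (insert ?q S) = Suc s"
          using S False finite_subset[OF S(1)] by simp
        moreover have "insert ?q S \<subseteq> {..<r}" using S(1) qr by simp
        ultimately show ?thesis by blast
      qed
    qed
  qed
qed

text \<open>Induction on the alphabet. Focusing with \<open>s = r\<close> uses up all colours, so
  the colour of the focus is that of one of the lines, which it completes.\<close>

theorem hales_jewett:
  assumes "finite A" "r \<ge> 1"
  shows "\<exists>d. \<forall>c. c ` words A d \<subseteq> {..<r} \<longrightarrow> has_mono_line A d r c"
  using assms
proof (induction A arbitrary: r rule: finite_induct)
  case empty
  have "[None] \<in> var_words {} 1" by (simp add: var_words_def)
  then show ?case using empty unfolding has_mono_line_def
    by (intro exI[of _ 1] allI impI bexI[of _ "[None]"] exI[of _ 0]) auto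
next
  case (insert b A)
  show ?case
  proof (cases "A = {}")
    \<comment> \<open>Focusing needs a letter \<open>a0\<close> in \<open>A\<close>; over a single
      letter every line is one word.\<close>
    case True
    have "has_mono_line (insert b A) 1 r c" if c: "c ` words (insert b A) 1 \<subseteq> {..<r}" for c
    proof -
      have "[b] \<in> words (insert b A) 1" by (simp add: words_def)
      then have "c [b] < r" using c by blast
      moreover have "[None] \<in> var_words (insert b A) 1" by (simp add: var_words_def)
      ultimately show ?thesis using True unfolding has_mono_line_def
        by (intro bexI[of _ "[None]"] exI[of _ "c [b]"]) (auto simp: fill_def)
    qed
    then show ?thesis by blast
  next
    case False
    then obtain a0 where "a0 \<in> A" by blast
    from colour_focusing[OF insert.hyps(1) this insert.IH, where b = b and r = r and s = r]
    obtain d where d: "\<And>c. c ` words (insert b A) d \<subseteq> {..<r} \<Longrightarrow>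
     has_mono_line (insert b A) d r c \<or>
     (\<exists>S\<subseteq>{..<r}. card S = r \<and> (\<exists>z. focused b A d c S z))"
      by blast
    have "has_mono_line (insert b A) d r c" if c: "c ` words (insert b A) d \<subseteq> {..<r}" for c
      using d[OF c]
    proof
      assume "\<exists>S\<subseteq>{..<r}. card S = r \<and> (\<exists>z. focused b A d c S z)"
      then obtain S z where S: "S \<subseteq> {..<r}" "card S = r" and foc: "focused b A d c S z"
        by blast
      have "S = {..<r}" using S by (simp add: card_subset_eq)
      moreover have z: "c z < r" using c foc unfolding focused_def by blast
      ultimately obtain w where "w \<in> var_words (insert b A) d" "fill b w = z"
        "\<forall>a\<in>A. c (fill a w) = c z"
        using foc unfolding focused_def by blast
      then show ?thesis using z unfolding has_mono_line_def
        by (intro bexI[of _ w] exI[of _ "c z"]) auto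
    qed
    then show ?thesis by blast
  qed
qed

section \<open>The partite construction\<close>

definition const_or_id :: "nat \<Rightarrow> (nat \<Rightarrow> nat) \<Rightarrow> bool" where
  "const_or_id k h \<longleftrightarrow> (\<forall>i\<in>{1..k}. h i = i) \<or> (\<exists>c. \<forall>i\<in>{1..k}. h i = c)"

definition separating :: "('x \<Rightarrow> nat) set \<Rightarrow> 'x set \<Rightarrow> bool" where
  "separating F X \<longleftrightarrow> (\<forall>x\<in>X. \<forall>y\<in>X. (\<forall>f\<in>F. f x = f y) \<longrightarrow> x = y)"

lemma separatingD:
  "separating F X \<Longrightarrow> x \<in> X \<Longrightarrow> y \<in> X \<Longrightarrow> (\<And>f. f \<in> F \<Longrightarrow> f x = f y) \<Longrightarrow> x = y"
  unfolding separating_def by blast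

definition abs_quasiline :: "nat \<Rightarrow> ('x \<Rightarrow> nat) set \<Rightarrow> 'x set \<Rightarrow> bool" where
  "abs_quasiline k F L \<longleftrightarrow>
     card L = k \<and> (\<forall>f\<in>F. (\<forall>x\<in>L. \<forall>y\<in>L. f x = f y) \<or> inj_on f L)"

text \<open>A finite subset of the cube \<open>[k]^F\<close> given by abstract points and their coordinate functions,
  together with some selected combinatorial lines \<open>e 1, \<dots>, e k\<close>. Edges are functions on all of
  \<open>nat\<close>, but only their values on \<open>{1..k}\<close> matter.\<close>

locale line_system =
  fixes k :: nat and X :: "'x set" and F :: "('x \<Rightarrow> nat) set" and E :: "(nat \<Rightarrow> 'x) set"
  assumes finite_points: "finite X" and finite_coords: "finite F" and finite_edges: "finite E"
    and coord_range: "f \<in> F \<Longrightarrow> x \<in> X \<Longrightarrow> f x \<in> {1..k}"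
    and edge_in: "e \<in> E \<Longrightarrow> i \<in> {1..k} \<Longrightarrow> e i \<in> X"
    and edge_inj: "e \<in> E \<Longrightarrow> inj_on e {1..k}"
    and edge_line: "e \<in> E \<Longrightarrow> f \<in> F \<Longrightarrow> const_or_id k (\<lambda>i. f (e i))"

definition ramsey :: "nat \<Rightarrow> nat \<Rightarrow> 'x set \<Rightarrow> (nat \<Rightarrow> 'x) set \<Rightarrow> bool" where
  "ramsey k r X E \<longleftrightarrow>
     (\<forall>c. c ` X \<subseteq> {..<r} \<longrightarrow> (\<exists>e\<in>E. \<exists>q. \<forall>i\<in>{1..k}. c (e i) = q))"

locale base_system = line_system k V T E
  for k :: nat and V :: "'v set" and T :: "('v \<Rightarrow> nat) set" and E :: "(nat \<Rightarrow> 'v) set" +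
  fixes r :: nat
  assumes k3: "k \<ge> 3" and r1: "r \<ge> 1"
begin

text \<open>If the coordinates \<open>T\<close> do not separate \<open>V\<close> (e.g. if \<open>T = {}\<close>), nothing is claimed about
  quasilines in \<open>X\<close> that are not selected lines.\<close>

definition picture :: "'x set \<Rightarrow> ('x \<Rightarrow> nat) set \<Rightarrow> (nat \<Rightarrow> 'x) set \<Rightarrow> ('x \<Rightarrow> 'v) \<Rightarrow> bool" where
  "picture X F \<Lambda> p \<longleftrightarrow> line_system k X F \<Lambda> \<and> separating F X \<and> p ` X \<subseteq> V \<and>
     (\<forall>l\<in>\<Lambda>. \<exists>e\<in>E. \<forall>i\<in>{1..k}. p (l i) = e i) \<and>
     (separating T V \<longrightarrow>
        (\<forall>L\<subseteq>X. abs_quasiline k F L \<longrightarrow> (\<exists>e\<in>E. p ` L = e ` {1..k})))"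

text \<open>The invariant of the construction: every edge has a selected copy in which the colour of
  the points over \<open>W\<close> depends only on their projection. One \<open>g\<close> serves all
  edges.\<close>

definition ramsey_over :: "'v set \<Rightarrow> 'x set \<Rightarrow> (nat \<Rightarrow> 'x) set \<Rightarrow> ('x \<Rightarrow> 'v) \<Rightarrow> bool" where
  "ramsey_over W X \<Lambda> p \<longleftrightarrow> (\<forall>c. c ` X \<subseteq> {..<r} \<longrightarrow> (\<exists>g. g ` W \<subseteq> {..<r} \<and>
     (\<forall>e\<in>E. \<exists>l\<in>\<Lambda>. \<forall>i\<in>{1..k}. p (l i) = e i \<and> (e i \<in> W \<longrightarrow> c (l i) = g (e i)))))"

text \<open>Disjoint copies of all edges: \<open>pos\<close> moves along every copy, and the
  two-valued \<open>ind e\<close> singles out the copy of \<open>e\<close>. Points are encoded as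
  numbers so that the iterated construction stays within one type.\<close>

lemma initial_picture:
  "\<exists>(X :: nat set) F \<Lambda> p. picture X F \<Lambda> p \<and> ramsey_over {} X \<Lambda> p"
proof -
  obtain h :: "(nat \<Rightarrow> 'v) \<Rightarrow> nat" where h: "inj_on h E"
    using finite_imp_inj_to_nat_seg[OF finite_edges] by blast
  define pt where "pt e i = prod_encode (h e, i)" for e i
  define X where "X = (\<lambda>(e, i). pt e i) ` (E \<times> {1..k})"
  define p where "p x = inv_into E h (fst (prod_decode x)) (snd (prod_decode x))" for x
  define ind where "ind e x = (if fst (prod_decode x) = h e then 1 else 2::nat)" for e x
  define pos where "pos x = snd (prod_decode x)" for x
  define F where "F = insert pos (ind ` E)"
  define \<Lambda> where "\<Lambda> = pt ` E"
  have p_pt: "p (pt e i) = e i" if "e \<in> E" for e i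
    using that h by (simp add: p_def pt_def)
  have pos_pt: "pos (pt e i) = i" for e i by (simp add: pos_def pt_def)
  have ind_pt: "ind e' (pt e i) = (if e = e' then 1 else 2)" if "e \<in> E" "e' \<in> E" for e e' i
    using that inj_on_eq_iff[OF h] by (simp add: ind_def pt_def)
  have pt_in: "pt e i \<in> X" if "e \<in> E" "i \<in> {1..k}" for e i
    using that by (auto simp: X_def)
  have X_E: "\<exists>e\<in>E. \<exists>i\<in>{1..k}. x = pt e i" if "x \<in> X" for x
    using that by (auto simp: X_def)
  have "line_system k X F \<Lambda>"
  proof
    show "finite X" "finite F" "finite \<Lambda>" using finite_edges by (auto simp: X_def F_def \<Lambda>_def)
    show "f x \<in> {1..k}" if f: "f \<in> F" and x: "x \<in> X" for f x
    proof -
      obtain e i where "e \<in> E" "i \<in> {1..k}" "x = pt e i" using X_E[OF x] by blast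
      then show ?thesis using f k3 by (auto simp: F_def pos_pt ind_pt)
    qed
    show "l i \<in> X" if "l \<in> \<Lambda>" "i \<in> {1..k}" for l i using that pt_in by (auto simp: \<Lambda>_def)
    show "inj_on l {1..k}" if l: "l \<in> \<Lambda>" for l
    proof -
      obtain e where "l = pt e" using l by (auto simp: \<Lambda>_def)
      then show ?thesis by (intro inj_on_inverseI[of _ pos]) (simp add: pos_pt)
    qed
    show "const_or_id k (\<lambda>i. f (l i))" if l: "l \<in> \<Lambda>" and f: "f \<in> F" for l f
      using l f by (auto simp: \<Lambda>_def F_def const_or_id_def pos_pt ind_pt)
  qed
  moreover have "separating F X"
    unfolding separating_def
  proof (intro ballI impI)
    fix x y assume x: "x \<in> X" and y: "y \<in> X" and eq: "\<forall>f\<in>F. f x = f y"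
    obtain e i where e: "e \<in> E" "x = pt e i" using X_E[OF x] by blast
    obtain e' i' where e': "e' \<in> E" "y = pt e' i'" using X_E[OF y] by blast
    have "i = i'" using eq e e' by (simp add: F_def pos_pt)
    moreover have "ind e x = ind e y" using eq e(1) by (simp add: F_def)
    then have "e = e'" using e e' by (simp add: ind_pt split: if_splits)
    ultimately show "x = y" using e e' by simp
  qed
  moreover have "p ` X \<subseteq> V"
  proof (rule image_subsetI)
    fix x assume "x \<in> X"
    then obtain e i where "e \<in> E" "i \<in> {1..k}" "x = pt e i" using X_E by blast
    then show "p x \<in> V" using edge_in by (simp add: p_pt)
  qed
  moreover have "\<forall>l\<in>\<Lambda>. \<exists>e\<in>E. \<forall>i\<in>{1..k}. p (l i) = e i"
    unfolding \<Lambda>_def using p_pt by auto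
  moreover have "\<exists>e\<in>E. p ` L = e ` {1..k}" if L: "L \<subseteq> X" "abs_quasiline k F L" for L
  proof -
    have card: "card L = k" using L(2) by (simp add: abs_quasiline_def)
    then obtain x0 where x0: "x0 \<in> L" using k3 by fastforce
    then obtain e i0 where e: "e \<in> E" "x0 = pt e i0" using X_E L(1) by blast
    \<comment> \<open>A two-valued coordinate cannot be injective on at least three points, so it is
      constant and confines \<open>L\<close> to one copy.\<close>
    have "\<not> inj_on (ind e) L"
    proof
      assume "inj_on (ind e) L"
      moreover have "ind e ` L \<subseteq> {1, 2}" by (auto simp: ind_def)
      ultimately have "card L \<le> card {1, 2::nat}" by (intro card_inj_on_le) auto
      then show False using card k3 by simp
    qed
    then have const: "ind e x = ind e x0" if "x \<in> L" for x
      using L(2) e(1) that x0 unfolding abs_quasiline_def F_def by blast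
    have "L \<subseteq> pt e ` {1..k}"
    proof
      fix x assume x: "x \<in> L"
      then obtain e' i where e': "e' \<in> E" "i \<in> {1..k}" "x = pt e' i" using X_E L(1) by blast
      have "ind e x = 1" unfolding const[OF x] e(2) by (simp add: ind_pt e(1))
      then have "e' = e" unfolding e'(3) ind_pt[OF e'(1) e(1)] by (simp split: if_splits)
      then show "x \<in> pt e ` {1..k}" using e' by simp
    qed
    moreover have "card (pt e ` {1..k}) \<le> k" using card_image_le[of "{1..k}" "pt e"] by simp
    ultimately have "L = pt e ` {1..k}" using card by (intro card_seteq) auto
    then have "p ` L = e ` {1..k}" using e(1) by (simp add: image_image p_pt)
    then show ?thesis by (rule bexI[OF _ e(1)])
  qed
  ultimately have "picture X F \<Lambda> p" by (simp add: picture_def)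
  moreover have "ramsey_over {} X \<Lambda> p"
    unfolding ramsey_over_def \<Lambda>_def using p_pt by auto
  ultimately show ?thesis by blast
qed

text \<open>Here \<open>q'\<close> agrees with an edge in all but at most one of its \<open>k \<ge> 3\<close> points. Two agreeing
  points decide whether a coordinate is fixed or moving, and hence its value at the last point.\<close>

lemma tag_determines_vertex:
  assumes T: "separating T V" and e: "e \<in> E" and L: "card L = k"
    and q: "bij_betw q L (e ` {1..k})" and y0: "y0 \<in> L" "q' y0 \<in> V"
    and agree: "\<And>y. y \<in> L \<Longrightarrow> y \<noteq> y0 \<Longrightarrow> q' y = q y"
    and quasi: "\<And>t. t \<in> T \<Longrightarrow> (\<forall>x\<in>L. \<forall>y\<in>L. t (q' x) = t (q' y)) \<or> inj_on (\<lambda>y. t (q' y)) L"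
  shows "q' y0 = q y0"
proof -
  have finL: "finite L" using L k3 by (intro card_ge_0_finite) simp
  have "\<not> card (L - {y0}) \<le> Suc 0" using L k3 finL y0 by simp
  then obtain y1 y2 where y12: "y1 \<in> L" "y2 \<in> L" "y1 \<noteq> y0" "y2 \<noteq> y0" "y1 \<noteq> y2"
    using card_le_Suc0_iff_eq[of "L - {y0}"] finL by blast
  have qe: "q y \<in> e ` {1..k}" if "y \<in> L" for y using q that bij_betwE by blast
  have "t (q' y0) = t (q y0)" if t: "t \<in> T" for t
    using edge_line[OF e t] unfolding const_or_id_def
  proof
    assume id: "\<forall>i\<in>{1..k}. t (e i) = i"
    have "inj_on t (e ` {1..k})" using id by (auto intro!: inj_onI)
    then have tq: "inj_on (\<lambda>y. t (q y)) L"
      using comp_inj_on[of q L t] q by (auto simp: bij_betw_def o_def)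
    then have "t (q' y1) \<noteq> t (q' y2)" using y12 agree by (auto dest: inj_onD)
    then have inj: "inj_on (\<lambda>y. t (q' y)) L" using quasi[OF t] y12 by blast
    have "(\<lambda>y. t (q' y)) ` L \<subseteq> {1..k}"
    proof (rule image_subsetI)
      fix y assume y: "y \<in> L"
      have "q y \<in> V" using qe[OF y] edge_in[OF e] by auto
      then have "q' y \<in> V" using agree[OF y] y0 by (cases "y = y0") auto
      then show "t (q' y) \<in> {1..k}" by (rule coord_range[OF t])
    qed
    \<comment> \<open>An injective coordinate takes all values on \<open>L\<close>. The value
      \<open>t (q y0)\<close> is not taken at any other point, since there \<open>q'\<close> agrees
      with \<open>q\<close> and \<open>t\<close> is injective along \<open>q\<close>.\<close>
    then have "(\<lambda>y. t (q' y)) ` L = {1..k}" using card_image[OF inj] L by (intro card_subset_eq) auto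
    moreover have "t (q y0) \<in> {1..k}" using id qe[OF y0(1)] by auto
    ultimately obtain y where y: "y \<in> L" "t (q' y) = t (q y0)" by (metis (no_types, lifting) imageE)
    have "y = y0"
    proof (rule ccontr)
      assume "y \<noteq> y0"
      then show False using agree[OF y(1)] y inj_onD[OF tq _ y(1) y0(1)] by simp
    qed
    then show ?thesis using y by simp
  next
    assume "\<exists>c. \<forall>i\<in>{1..k}. t (e i) = c"
    then obtain c where "\<And>i. i \<in> {1..k} \<Longrightarrow> t (e i) = c" by blast
    then have c: "t (q y) = c" if "y \<in> L" for y using qe[OF that] by auto
    then have "t (q' y1) = t (q' y2)" using agree y12 by simp
    then have "\<forall>x\<in>L. \<forall>y\<in>L. t (q' x) = t (q' y)" using quasi[OF t] y12 by (auto dest: inj_onD)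
    then show ?thesis using c agree y12 y0 by metis
  qed
  moreover have "q y0 \<in> V" using qe[OF y0(1)] edge_in[OF e] by auto
  ultimately show ?thesis by (intro separatingD[OF T y0(2)])
qed

text \<open>Each variable word over the part \<open>A\<close> of \<open>X\<close> above
  \<open>v\<close> carries a copy of \<open>X\<close>: a point is plugged into the wildcards, even
  if it lies outside \<open>A\<close>. A Hales-Jewett line is the part of such a copy above
  \<open>v\<close>; once it is monochromatic, the hypothesis for \<open>W\<close> is applied inside
  that copy.\<close>

lemma amalgamation:
  fixes X :: "nat set"
  assumes pic: "picture X F \<Lambda> p" and ram: "ramsey_over W X \<Lambda> p" and v: "v \<in> V"
  shows "\<exists>(X' :: nat set) F' \<Lambda>' p'. picture X' F' \<Lambda>' p' \<and> ramsey_over (insert v W) X' \<Lambda>' p'"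
proof -
  interpret S: line_system k X F \<Lambda> using pic by (simp add: picture_def)
  have sep: "separating F X" and pV: "\<And>x. x \<in> X \<Longrightarrow> p x \<in> V"
    and proj: "\<And>l. l \<in> \<Lambda> \<Longrightarrow> \<exists>e\<in>E. \<forall>i\<in>{1..k}. p (l i) = e i"
    and quasi: "\<And>L. separating T V \<Longrightarrow> L \<subseteq> X \<Longrightarrow> abs_quasiline k F L \<Longrightarrow> \<exists>e\<in>E. p ` L = e ` {1..k}"
    using pic unfolding picture_def by blast+
  define A where "A = {x \<in> X. p x = v}"
  have finA: "finite A" using S.finite_points by (simp add: A_def)
  obtain d where d: "\<And>c. c ` words A d \<subseteq> {..<r} \<Longrightarrow> has_mono_line A d r c"
    using hales_jewett[OF finA r1] by blast
  define pt where "pt w x = list_encode (fill x w)" for w :: "nat option list" and x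
  define X' where "X' = (\<lambda>(w, x). pt w x) ` (var_words A d \<times> X)"
  \<comment> \<open>A point with all letters in \<open>A\<close> lies over \<open>v\<close>;
    otherwise exactly one letter lies outside \<open>A\<close>, namely the one filling the
    wildcards.\<close>
  define p' where "p' y = (let s = set (list_decode y) in
      if s \<subseteq> A then v else p (SOME a. a \<in> s - A))" for y
  define blk where "blk j y = list_decode y ! j" for j y
  \<comment> \<open>The projection becomes part of the coordinates, which is what controls quasilines.\<close>
  define F' where "F' = (\<lambda>(f, j) y. f (blk j y)) ` (F \<times> {..<d}) \<union> (\<lambda>t y. t (p' y)) ` T"
  define \<Lambda>' where "\<Lambda>' = (\<lambda>(w, l) i. pt w (l i)) ` (var_words A d \<times> \<Lambda>)"
  have X'E: "\<exists>w\<in>var_words A d. \<exists>x\<in>X. y = pt w x" if "y \<in> X'" for y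
    using that by (auto simp: X'_def)
  have pt_in: "pt w x \<in> X'" if "w \<in> var_words A d" "x \<in> X" for w x
    using that by (auto simp: X'_def)
  have len: "length w = d" if "w \<in> var_words A d" for w
    using that by (simp add: var_words_def)
  have p'_pt: "p' (pt w x) = p x" if w: "w \<in> var_words A d" and x: "x \<in> X" for w x
  proof (cases "x \<in> A")
    case True
    then have "set (fill x w) \<subseteq> A" using set_fill_subset[OF w, of x] by auto
    then show ?thesis using True by (simp add: p'_def pt_def A_def)
  next
    case False
    then have "set (fill x w) - A = {x}"
      using set_fill_subset[OF w, of x] mem_set_fill[OF w, of x] by auto
    then show ?thesis using False by (auto simp: p'_def pt_def Let_def)
  qed
  have blk_pt: "blk j (pt w x) = case_option x id (w ! j)" if "w \<in> var_words A d" "j < d" for j w x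
    using that len by (simp add: blk_def pt_def nth_fill)
  have blk_cases: "blk j (pt w x) = x \<or> blk j (pt w x) \<in> A" if w: "w \<in> var_words A d" and j: "j < d" for j w x
  proof -
    have "fill x w ! j \<in> set (fill x w)" using len[OF w] j by simp
    then show ?thesis using set_fill_subset[OF w, of x] by (auto simp: blk_def pt_def)
  qed
  have blk_in: "blk j y \<in> X" if y: "y \<in> X'" "j < d" for j y
  proof -
    obtain w x where "w \<in> var_words A d" "x \<in> X" "y = pt w x" using X'E[OF y(1)] by blast
    then show ?thesis using blk_cases[OF _ y(2), of w x] by (auto simp: A_def)
  qed
  have blk_eqI: "y = z" if y: "y \<in> X'" and z: "z \<in> X'" and eq: "\<And>j. j < d \<Longrightarrow> blk j y = blk j z" for y z
  proof -
    have "length (list_decode y) = d" "length (list_decode z) = d"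
      using X'E[OF y] X'E[OF z] len by (auto simp: pt_def)
    then have "list_decode y = list_decode z" using eq by (intro nth_equalityI) (auto simp: blk_def)
    then show ?thesis by (metis list_decode_inverse)
  qed
  \<comment> \<open>The fixed letters of a variable word lie over \<open>v\<close>, so a block with
    another projection sits at a wildcard and equals \<open>x\<close>.\<close>
  have blk_out: "p' y = p (blk j y)" if y: "y \<in> X'" "j < d" "p (blk j y) \<noteq> v" for j y
  proof -
    obtain w x where w: "w \<in> var_words A d" "x \<in> X" "y = pt w x" using X'E[OF y(1)] by blast
    have "blk j y = x" using blk_cases[OF w(1) y(2), of x] y(3) w by (auto simp: A_def)
    then show ?thesis using p'_pt w by simp
  qed
  have p'V: "p' y \<in> V" if "y \<in> X'" for y
    using X'E[OF that] p'_pt pV by auto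
  have \<Lambda>'E: "\<exists>w\<in>var_words A d. \<exists>l\<in>\<Lambda>. m = (\<lambda>i. pt w (l i))" if "m \<in> \<Lambda>'" for m
    using that by (auto simp: \<Lambda>'_def)
  have F'E: "(\<exists>f\<in>F. \<exists>j<d. g = (\<lambda>y. f (blk j y))) \<or> (\<exists>t\<in>T. g = (\<lambda>y. t (p' y)))" if "g \<in> F'" for g
    using that by (auto simp: F'_def)
  have blk_F': "(\<lambda>y. f (blk j y)) \<in> F'" if "f \<in> F" "j < d" for f j
    using that by (auto simp: F'_def)
  have tag_F': "(\<lambda>y. t (p' y)) \<in> F'" if "t \<in> T" for t
    using that by (auto simp: F'_def)
  have proj': "\<exists>e\<in>E. \<forall>i\<in>{1..k}. p' (m i) = e i" if m: "m \<in> \<Lambda>'" for m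
  proof -
    obtain w l where wl: "w \<in> var_words A d" "l \<in> \<Lambda>" "m = (\<lambda>i. pt w (l i))"
      using \<Lambda>'E[OF m] by blast
    have "p' (m i) = p (l i)" if "i \<in> {1..k}" for i
      using p'_pt[OF wl(1) S.edge_in[OF wl(2) that]] wl(3) by simp
    then show ?thesis using proj[OF wl(2)] by simp
  qed
  have "line_system k X' F' \<Lambda>'"
  proof
    show "finite X'" "finite F'" "finite \<Lambda>'"
      using finite_var_words[OF finA] S.finite_points S.finite_coords S.finite_edges finite_coords
      by (auto simp: X'_def F'_def \<Lambda>'_def)
    show "g y \<in> {1..k}" if "g \<in> F'" "y \<in> X'" for g y
      using F'E[OF that(1)] S.coord_range blk_in[OF that(2)] coord_range p'V[OF that(2)] by blast
    show "m i \<in> X'" if "m \<in> \<Lambda>'" "i \<in> {1..k}" for m i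
      using \<Lambda>'E[OF that(1)] S.edge_in that(2) pt_in by blast
    show "inj_on m {1..k}" if m: "m \<in> \<Lambda>'" for m
    proof -
      obtain e where "e \<in> E" "\<forall>i\<in>{1..k}. p' (m i) = e i" using proj'[OF m] by blast
      then show ?thesis using edge_inj[of e] by (metis inj_on_def)
    qed
    show "const_or_id k (\<lambda>i. g (m i))" if m: "m \<in> \<Lambda>'" and g: "g \<in> F'" for m g
      using F'E[OF g]
    proof (elim disjE bexE exE conjE)
      fix f j assume f: "f \<in> F" "j < d" "g = (\<lambda>y. f (blk j y))"
      obtain w l where wl: "w \<in> var_words A d" "l \<in> \<Lambda>" "m = (\<lambda>i. pt w (l i))"
        using \<Lambda>'E[OF m] by blast
      show ?thesis
      proof (cases "w ! j")
        case None
        then have "(\<lambda>i. g (m i)) = (\<lambda>i. f (l i))" using f wl by (simp add: blk_pt)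
        then show ?thesis using S.edge_line[OF wl(2) f(1)] by simp
      next
        case (Some a)
        then show ?thesis using f wl by (simp add: blk_pt const_or_id_def)
      qed
    next
      fix t assume t: "t \<in> T" "g = (\<lambda>y. t (p' y))"
      obtain e where e: "e \<in> E" "\<forall>i\<in>{1..k}. p' (m i) = e i" using proj'[OF m] by blast
      show ?thesis using edge_line[OF e(1) t(1)] e(2) t(2) by (simp add: const_or_id_def)
    qed
  qed
  moreover have "separating F' X'"
    unfolding separating_def
  proof (intro ballI impI)
    fix y z assume y: "y \<in> X'" and z: "z \<in> X'" and eq: "\<forall>g\<in>F'. g y = g z"
    have "blk j y = blk j z" if "j < d" for j
    proof -
      have "f (blk j y) = f (blk j z)" if "f \<in> F" for f
        using bspec[OF eq blk_F'[OF that \<open>j < d\<close>]] .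
      then show ?thesis by (rule separatingD[OF sep blk_in[OF y that] blk_in[OF z that]])
    qed
    then show "y = z" by (rule blk_eqI[OF y z])
  qed
  moreover have "\<exists>e\<in>E. p' ` L = e ` {1..k}"
    if T: "separating T V" and L: "L \<subseteq> X'" "abs_quasiline k F' L" for L
  proof -
    have cardL: "card L = k" and LF: "\<And>g. g \<in> F' \<Longrightarrow> (\<forall>x\<in>L. \<forall>y\<in>L. g x = g y) \<or> inj_on g L"
      using L(2) unfolding abs_quasiline_def by blast+
    have finL: "finite L" using cardL k3 by (intro card_ge_0_finite) simp
    have "\<not> card L \<le> Suc 0" using cardL k3 by simp
    then obtain y z where yz: "y \<in> L" "z \<in> L" "y \<noteq> z"
      using card_le_Suc0_iff_eq[OF finL] by blast
    \<comment> \<open>A block that is not constant on \<open>L\<close> must be injective on it, and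
      its image is a quasiline of \<open>X\<close>.\<close>
    have "\<exists>j<d. blk j y \<noteq> blk j z"
      using blk_eqI[of y z] yz L(1) by blast
    then obtain j where j: "j < d" "blk j y \<noteq> blk j z" by blast
    have blkX: "blk j x \<in> X" if "x \<in> L" for x using blk_in[OF _ j(1)] that L(1) by blast
    obtain f where f: "f \<in> F" "f (blk j y) \<noteq> f (blk j z)"
      using separatingD[OF sep blkX[OF yz(1)] blkX[OF yz(2)]] j(2) by blast
    have "inj_on (\<lambda>y. f (blk j y)) L" using LF[OF blk_F'[OF f(1) j(1)]]
    proof
      assume "\<forall>u\<in>L. \<forall>v\<in>L. f (blk j u) = f (blk j v)"
      then show ?thesis using yz f(2) by blast
    qed
    then have injb: "inj_on (blk j) L" by (auto simp: inj_on_def)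
    have "abs_quasiline k F (blk j ` L)"
      unfolding abs_quasiline_def
    proof (intro conjI ballI)
      show "card (blk j ` L) = k" using card_image[OF injb] cardL by simp
      fix f assume "f \<in> F"
      from LF[OF blk_F'[OF this j(1)]]
      show "(\<forall>x\<in>blk j ` L. \<forall>y\<in>blk j ` L. f x = f y) \<or> inj_on f (blk j ` L)"
        by (auto simp: inj_on_def)
    qed
    then obtain e where e: "e \<in> E" "p ` blk j ` L = e ` {1..k}"
      using quasi[OF T] blkX by (metis image_subsetI)
    let ?q = "\<lambda>y. p (blk j y)"
    have img: "?q ` L = e ` {1..k}" using e(2) by (simp add: image_image)
    have "card (e ` {1..k}) = k" using card_image[OF edge_inj[OF e(1)]] by simp
    then have injq: "inj_on ?q L" using img cardL finL by (intro eq_card_imp_inj_on) auto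
    \<comment> \<open>As \<open>?q\<close> is injective on \<open>L\<close>, at most one point has
      its block over \<open>v\<close>. The others project correctly by \<open>blk_out\<close>, and
      the tags settle the exceptional one.\<close>
    have "p' y = ?q y" if y: "y \<in> L" for y
    proof (cases "?q y = v")
      case False
      then show ?thesis using blk_out[OF _ j(1)] y L(1) by blast
    next
      case True
      show ?thesis
      proof (rule tag_determines_vertex[OF T e(1) cardL, where q = ?q and q' = p'])
        show "bij_betw ?q L (e ` {1..k})" using injq img by (simp add: bij_betw_def)
        show "y \<in> L" "p' y \<in> V" using y p'V L(1) by auto
        show "p' x = ?q x" if "x \<in> L" "x \<noteq> y" for x
        proof (rule blk_out[OF _ j(1)])
          show "x \<in> X'" using that L(1) by blast
          show "?q x \<noteq> v" using True inj_onD[OF injq, of x y] that y by auto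
        qed
        show "(\<forall>x\<in>L. \<forall>y\<in>L. t (p' x) = t (p' y)) \<or> inj_on (\<lambda>y. t (p' y)) L" if "t \<in> T" for t
          by (rule LF[OF tag_F'[OF that]])
      qed
    qed
    then have "p' ` L = ?q ` L" by (intro image_cong) auto
    then have "p' ` L = e ` {1..k}" unfolding img .
    then show ?thesis by (rule bexI[OF _ e(1)])
  qed
  ultimately have "picture X' F' \<Lambda>' p'"
    using proj' p'V unfolding picture_def image_subset_iff by simp
  moreover have "ramsey_over (insert v W) X' \<Lambda>' p'"
    unfolding ramsey_over_def
  proof (intro allI impI)
    fix c assume c: "c ` X' \<subseteq> {..<r}"
    \<comment> \<open>Words over \<open>A\<close> outside \<open>X'\<close> get the default 0, a
      legal colour as \<open>r\<close> is positive; the points of the line found below all lie in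
      \<open>X'\<close>.\<close>
    let ?c = "\<lambda>u. if list_encode u \<in> X' then c (list_encode u) else 0"
    have "?c ` words A d \<subseteq> {..<r}" using c r1 by auto
    from d[OF this] obtain w q where w: "w \<in> var_words A d" and q: "q < r"
      and mono: "\<And>a. a \<in> A \<Longrightarrow> ?c (fill a w) = q"
      unfolding has_mono_line_def by blast
    have mono': "c (pt w a) = q" if "a \<in> A" for a
      using mono[OF that] pt_in[OF w, of a] that by (simp add: pt_def A_def)
    have "(\<lambda>x. c (pt w x)) ` X \<subseteq> {..<r}" using c pt_in[OF w] by blast
    from ram[unfolded ramsey_over_def, rule_format, OF this] obtain g
      where g: "g ` W \<subseteq> {..<r}" and ge: "\<forall>e\<in>E. \<exists>l\<in>\<Lambda>. \<forall>i\<in>{1..k}. p (l i) = e i \<and>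
        (e i \<in> W \<longrightarrow> c (pt w (l i)) = g (e i))"
      by (elim exE conjE) (rule that)
    show "\<exists>g. g ` insert v W \<subseteq> {..<r} \<and> (\<forall>e\<in>E. \<exists>l\<in>\<Lambda>'. \<forall>i\<in>{1..k}.
        p' (l i) = e i \<and> (e i \<in> insert v W \<longrightarrow> c (l i) = g (e i)))"
    proof (intro exI[of _ "g(v := q)"] conjI ballI)
      show "(g(v := q)) ` insert v W \<subseteq> {..<r}" using g q by auto
      fix e assume e: "e \<in> E"
      from bspec[OF ge e] obtain l where l: "l \<in> \<Lambda>" and li: "\<And>i. i \<in> {1..k} \<Longrightarrow> p (l i) = e i"
        "\<And>i. i \<in> {1..k} \<Longrightarrow> e i \<in> W \<Longrightarrow> c (pt w (l i)) = g (e i)"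
        by blast
      have "(\<lambda>i. pt w (l i)) \<in> \<Lambda>'" using w l by (auto simp: \<Lambda>'_def)
      moreover have "p' (pt w (l i)) = e i \<and>
          (e i \<in> insert v W \<longrightarrow> c (pt w (l i)) = (g(v := q)) (e i))" if i: "i \<in> {1..k}" for i
      proof -
        have lX: "l i \<in> X" using S.edge_in[OF l i] .
        show ?thesis
        proof (cases "e i = v")
          case True
          then have "l i \<in> A" using lX li(1)[OF i] by (simp add: A_def)
          then show ?thesis using True mono' p'_pt[OF w lX] li(1)[OF i] by simp
        next
          case False
          then show ?thesis using p'_pt[OF w lX] li(1)[OF i] li(2)[OF i] by simp
        qed
      qed
      ultimately show "\<exists>l\<in>\<Lambda>'. \<forall>i\<in>{1..k}. p' (l i) = e i \<and>
          (e i \<in> insert v W \<longrightarrow> c (l i) = (g(v := q)) (e i))"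
        by (intro bexI[of _ "\<lambda>i. pt w (l i)"] ballI)
    qed
  qed
  ultimately show ?thesis by blast
qed

text \<open>Amalgamation is iterated over all vertices. With \<open>W = V\<close> a colouring of
  \<open>X\<close> induces a colouring \<open>g\<close> of \<open>V\<close>, and an edge
  monochromatic for \<open>g\<close> has a monochromatic copy.\<close>

theorem partite_construction:
  assumes ram: "ramsey k r V E"
  shows "\<exists>(X :: nat set) F \<Lambda> p. picture X F \<Lambda> p \<and> ramsey k r X \<Lambda>"
proof -
  have "\<exists>(X :: nat set) F \<Lambda> p. picture X F \<Lambda> p \<and> ramsey_over W X \<Lambda> p" if "W \<subseteq> V" for W
    using finite_subset[OF that finite_points] that
  proof (induction W rule: finite_induct)
    case empty
    show ?case by (rule initial_picture)
  next
    case (insert v W)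
    then obtain X :: "nat set" and F \<Lambda> p where "picture X F \<Lambda> p" "ramsey_over W X \<Lambda> p" by auto
    then show ?case using amalgamation[of X F \<Lambda> p W v] insert.prems by simp
  qed
  then obtain X :: "nat set" and F \<Lambda> p where pic: "picture X F \<Lambda> p" and ro: "ramsey_over V X \<Lambda> p"
    by blast
  have "\<exists>l\<in>\<Lambda>. \<exists>q. \<forall>i\<in>{1..k}. c (l i) = q" if c: "c ` X \<subseteq> {..<r}" for c
  proof -
    from ro[unfolded ramsey_over_def, rule_format, OF c] obtain g where g: "g ` V \<subseteq> {..<r}"
      and ge: "\<forall>e\<in>E. \<exists>l\<in>\<Lambda>. \<forall>i\<in>{1..k}. p (l i) = e i \<and> (e i \<in> V \<longrightarrow> c (l i) = g (e i))"
      by (elim exE conjE) (rule that)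
    obtain e q where e: "e \<in> E" "\<forall>i\<in>{1..k}. g (e i) = q"
      using ram[unfolded ramsey_def, rule_format, OF g] by blast
    obtain l where "l \<in> \<Lambda>" "\<forall>i\<in>{1..k}. p (l i) = e i \<and> (e i \<in> V \<longrightarrow> c (l i) = g (e i))"
      using bspec[OF ge e(1)] by blast
    then show ?thesis using e edge_in[OF e(1)] by (intro bexI[of _ l] exI[of _ q]) auto
  qed
  then show ?thesis using pic unfolding ramsey_def by blast
qed

end

section \<open>The window hypergraph\<close>

definition window :: "nat \<Rightarrow> (nat \<Rightarrow> nat) \<Rightarrow> nat \<Rightarrow> nat set" where
  "window m b i = b ` {i..<i + m}"

definition window_edges :: "nat \<Rightarrow> nat \<Rightarrow> nat \<Rightarrow> (nat \<Rightarrow> nat set) set" where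
  "window_edges k m N =
     window m ` {b \<in> {..<k + m} \<rightarrow>\<^sub>E {..<N}. strict_mono_on {..<k + m} b}"

lemma window_edgesE:
  assumes "e \<in> window_edges k m N"
  obtains b where "e = window m b" "strict_mono_on {..<k + m} b" "b ` {..<k + m} \<subseteq> {..<N}"
  using assms unfolding window_edges_def by blast

lemma window_in_nsets:
  assumes "strict_mono_on {..<k + m} b" "b ` {..<k + m} \<subseteq> B" "i \<in> {1..k}"
  shows "window m b i \<in> nsets B m"
proof -
  have sub: "{i..<i + m} \<subseteq> {..<k + m}" using assms(3) by auto
  have "inj_on b {i..<i + m}"
    using strict_mono_on_imp_inj_on[OF assms(1)] sub by (rule inj_on_subset)
  then show ?thesis using assms(2) sub by (auto simp: window_def nsets_def card_image)
qed

text \<open>Windows carry no coordinates, so the coordinate conditions are vacuous. Edges are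
  injective because their windows come from distinct nonempty index intervals.\<close>

lemma line_system_windows:
  assumes "m \<ge> 1"
  shows "line_system k (nsets {..<N} m) {} (window_edges k m N)"
proof
  show "finite (nsets {..<N} m)" by (simp add: finite_imp_finite_nsets)
  show "finite (window_edges k m N)" unfolding window_edges_def by (simp add: finite_PiE)
  show "e i \<in> nsets {..<N} m" if "e \<in> window_edges k m N" "i \<in> {1..k}" for e i
    using that window_in_nsets by (metis window_edgesE)
  show "inj_on e {1..k}" if e: "e \<in> window_edges k m N" for e
  proof (rule inj_onI)
    fix i j assume ij: "i \<in> {1..k}" "j \<in> {1..k}" "e i = e j"
    obtain b where b: "e = window m b" "strict_mono_on {..<k + m} b" using e by (rule window_edgesE)
    have "{i..<i + m} \<subseteq> {..<k + m}" "{j..<j + m} \<subseteq> {..<k + m}" using ij by auto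
    then have "{i..<i + m} = {j..<j + m}"
      using ij inj_on_image_eq_iff[OF strict_mono_on_imp_inj_on[OF b(2)], of "{i..<i + m}" "{j..<j + m}"]
      by (simp add: b(1) window_def)
    then show "i = j" using assms by (simp add: atLeastLessThan_eq_iff)
  qed
qed auto

text \<open>A homogeneous set of size \<open>k + m\<close> for the colouring of
  \<open>m\<close>-sets is enumerated increasingly; all windows of this sequence are
  \<open>m\<close>-subsets of it.\<close>

lemma ramsey_windows: "\<exists>N. ramsey k r (nsets {..<N} m) (window_edges k m N)"
proof -
  obtain N :: nat where N: "partn_lst {..<N} (replicate r (k + m)) m"
    using ramsey_full by blast
  have "\<exists>e\<in>window_edges k m N. \<exists>q. \<forall>i\<in>{1..k}. c (e i) = q"
    if c: "c ` nsets {..<N} m \<subseteq> {..<r}" for c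
  proof -
    have "c \<in> nsets {..<N} m \<rightarrow> {..<r}" using c by blast
    then obtain q H where H: "H \<in> nsets {..<N} (k + m)" "c ` nsets H m \<subseteq> {q}"
      using partn_lstE[OF N, of c r] by (metis length_replicate nth_replicate)
    have fin: "finite H" "card H = k + m" "H \<subseteq> {..<N}" using H(1) by (auto simp: nsets_def)
    define b where "b = restrict (\<lambda>i. sorted_list_of_set H ! i) {..<k + m}"
    have len: "length (sorted_list_of_set H) = k + m" using fin by simp
    have bH: "b ` {..<k + m} \<subseteq> H"
    proof (rule image_subsetI)
      fix i assume "i \<in> {..<k + m}"
      then have "b i \<in> set (sorted_list_of_set H)" using len by (simp add: b_def del: set_sorted_list_of_set)
      then show "b i \<in> H" using fin by simp
    qed
    have mono: "strict_mono_on {..<k + m} b"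
    proof (rule strict_mono_onI)
      fix i j assume "i \<in> {..<k + m}" "j \<in> {..<k + m}" "i < j"
      then show "b i < b j"
        using sorted_wrt_nth_less[OF strict_sorted_list_of_set[of H], of i j] len by (simp add: b_def)
    qed
    have "b \<in> {..<k + m} \<rightarrow>\<^sub>E {..<N}" using bH fin(3) by (auto simp: b_def)
    then have "window m b \<in> window_edges k m N" using mono by (simp add: window_edges_def)
    moreover have "c (window m b i) = q" if "i \<in> {1..k}" for i
      using window_in_nsets[OF mono bH that] H(2) by blast
    ultimately show ?thesis by blast
  qed
  then show ?thesis unfolding ramsey_def by blast
qed

text \<open>Numbers of colour \<open>0\<close> are markers. As long as no new marker enters, the gap behind the last
  marker grows by one from each window to the next, so it runs through all residues modulo \<open>k\<close>.
  The phase \<open>s\<close> makes its residue equidistributed.\<close>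

definition last_marker :: "(nat \<Rightarrow> nat) \<Rightarrow> nat set \<Rightarrow> nat" where
  "last_marker c A = Max {a \<in> A. c a = 0}"

definition gap :: "(nat \<Rightarrow> nat) \<Rightarrow> nat set \<Rightarrow> nat" where
  "gap c A = card {a \<in> A. last_marker c A < a}"

definition good :: "nat \<Rightarrow> (nat \<Rightarrow> nat) \<Rightarrow> nat \<Rightarrow> nat set \<Rightarrow> bool" where
  "good k c s A \<longleftrightarrow> (\<exists>a\<in>A. c a = 0) \<and> c (Max A) \<noteq> 0 \<and> (gap c A + s) mod k \<noteq> 0"

text \<open>If all windows were good, none would end in a marker, so no index from \<open>m\<close>
  to \<open>k + m - 1\<close> is marked. A marker of the last window then lies in all
  \<open>k\<close> windows, which therefore share their last marker. Their gaps are \<open>k\<close>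
  consecutive numbers, and one hits the forbidden residue.\<close>

lemma window_not_all_good:
  assumes k: "k \<ge> 1" and m: "m \<ge> 1" and e: "e \<in> window_edges k m N"
  shows "\<exists>i\<in>{1..k}. \<not> good k c s (e i)"
proof (rule ccontr)
  assume "\<not> ?thesis"
  then have good: "\<And>i. i \<in> {1..k} \<Longrightarrow> good k c s (e i)" by blast
  obtain b where eb: "e = window m b" and b: "strict_mono_on {..<k + m} b"
    using e by (rule window_edgesE)
  have less: "b i < b j \<longleftrightarrow> i < j" if "i < k + m" "j < k + m" for i j
    using strict_mono_on_less[OF b] that by simp
  have le: "b i \<le> b j" if "i \<le> j" "j < k + m" for i j
    using less[of j i] that by (simp flip: not_less)
  have maxw: "Max (e i) = b (i + m - 1)" if i: "i \<in> {1..k}" for i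
  proof (rule Max_eqI)
    show "finite (e i)" by (simp add: eb window_def)
    show "b (i + m - 1) \<in> e i" using m i by (simp add: eb window_def)
    fix y assume "y \<in> e i"
    then obtain j where "y = b j" "j \<in> {i..<i + m}" by (auto simp: eb window_def)
    then show "y \<le> b (i + m - 1)"
      using le[of j "i + m - 1"] i by auto
  qed
  have nomark: "c (b (i + m - 1)) \<noteq> 0" if "i \<in> {1..k}" for i
    using good[OF that] maxw[OF that] by (simp add: good_def)
  define P where "P = {t \<in> {1..<m}. c (b t) = 0}"
  have idx: "c (b t) = 0 \<longleftrightarrow> t \<in> P" if "t \<in> {1..<k + m}" for t
  proof (cases "t < m")
    case True
    then show ?thesis using that by (simp add: P_def)
  next
    case False
    \<comment> \<open>Index \<open>t\<close> is the end of window \<open>t + 1 - m\<close>.\<close>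
    then have "t + 1 - m \<in> {1..k}" "t + 1 - m + m - 1 = t" using that by auto
    then have "c (b t) \<noteq> 0" using nomark[of "t + 1 - m"] by simp
    then show ?thesis using False by (simp add: P_def)
  qed
  have "\<exists>t\<in>{k..<k + m}. c (b t) = 0" using good[of k] k by (auto simp: good_def eb window_def)
  then obtain t0 where t0: "t0 \<in> P" "t0 \<ge> k" using idx k by fastforce
  define t where "t = Max P"
  have finP: "finite P" by (simp add: P_def)
  have t: "t \<in> P" "t \<ge> k" "t < m"
  proof -
    show tP: "t \<in> P" using Max_in[OF finP] t0 by (auto simp: t_def)
    show "t \<ge> k" using Max_ge[OF finP t0(1)] t0(2) by (simp add: t_def)
    show "t < m" using tP by (simp add: P_def)
  qed
  have gap: "gap c (e i) = i + m - 1 - t" if i: "i \<in> {1..k}" for i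
  proof -
    have "last_marker c (e i) = b t"
      unfolding last_marker_def
    proof (rule Max_eqI)
      show "finite {a \<in> e i. c a = 0}" by (simp add: eb window_def)
      show "b t \<in> {a \<in> e i. c a = 0}" using t i by (auto simp: eb window_def P_def)
      fix y assume "y \<in> {a \<in> e i. c a = 0}"
      then obtain j where j: "y = b j" "j \<in> {i..<i + m}" "c (b j) = 0" by (auto simp: eb window_def)
      then have "j \<in> P" using idx[of j] i by auto
      then have "j \<le> t" using finP by (simp add: t_def)
      then show "y \<le> b t" using le[of j t] j t by simp
    qed
    then have "{a \<in> e i. last_marker c (e i) < a} = b ` {t<..<i + m}"
      using less t i by (auto simp: eb window_def)
    moreover have "inj_on b {t<..<i + m}"
      using strict_mono_on_imp_inj_on[OF b] by (rule inj_on_subset) (use i in auto)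
    ultimately show ?thesis by (simp add: gap_def card_image)
  qed
  define z where "z = (m - t + s) mod k"
  have "z < k" using k by (simp add: z_def)
  \<comment> \<open>\<open>i - 1\<close> is the residue of \<open>-z\<close> modulo
    \<open>k\<close>, so gap plus phase becomes divisible by \<open>k\<close>.\<close>
  define i where "i = (if z = 0 then 1 else k - z + 1)"
  have i: "i \<in> {1..k}" using \<open>z < k\<close> k by (auto simp: i_def)
  have "gap c (e i) + s = (m - t + s) + (i - 1)" using gap[OF i] t i by auto
  then have "(gap c (e i) + s) mod k = (z + (i - 1)) mod k" by (simp only: z_def mod_add_left_eq)
  also have "\<dots> = 0" using \<open>z < k\<close> by (auto simp: i_def)
  finally show False using good[OF i] by (simp add: good_def)
qed

text \<open>Union bound for a uniformly random map to \<open>{..<D}\<close> and phase, where each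
  number is a marker with probability \<open>1 / D\<close>. The three terms stand for no marker, a
  marker at the maximum, and the one forbidden phase of each marking.\<close>

lemma card_bad_le:
  fixes D N m k :: nat
  assumes A: "A \<in> nsets {..<N} m" and m: "m \<ge> 1" and D: "D \<ge> 1" and k: "k \<ge> 1"
  defines "\<Omega> \<equiv> ({..<N} \<rightarrow>\<^sub>E {..<D}) \<times> {..<k}"
  shows "real (card {\<omega> \<in> \<Omega>. \<not> good k (fst \<omega>) (snd \<omega>) A}) \<le>
    ((1 - 1 / D) ^ m + 1 / D + 1 / k) * card \<Omega>"
proof -
  let ?C = "{..<N} \<rightarrow>\<^sub>E {..<D}"
  have AN: "A \<subseteq> {..<N}" and cA: "card A = m" and fA: "finite A" using A by (auto simp: nsets_def)
  have finC: "finite ?C" by (simp add: finite_PiE)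
  have cardC: "card ?C = D ^ N" by (simp add: card_PiE)
  have mN: "m \<le> N" using card_mono[OF _ AN] cA by simp
  define B1 where "B1 = {c \<in> ?C. \<forall>a\<in>A. c a \<noteq> 0}"
  define B2 where "B2 = {c \<in> ?C. c (Max A) = 0}"
  define B3 where "B3 = {(c, s) \<in> \<Omega>. (gap c A + s) mod k = 0}"
  have "B1 = PiE {..<N} (\<lambda>a. if a \<in> A then {1..<D} else {..<D})"
  proof (rule set_eqI)
    fix c
    have "c i \<in> (if i \<in> A then {1..<D} else {..<D}) \<longleftrightarrow> c i \<in> {..<D} \<and> (i \<in> A \<longrightarrow> c i \<noteq> 0)" for i
      by auto
    then show "c \<in> B1 \<longleftrightarrow> c \<in> PiE {..<N} (\<lambda>a. if a \<in> A then {1..<D} else {..<D})"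
      using AN unfolding B1_def mem_Collect_eq PiE_iff by blast
  qed
  then have "card B1 = (\<Prod>a<N. card (if a \<in> A then {1..<D} else {..<D}))" by (simp add: card_PiE)
  also have "\<dots> = (\<Prod>a<N. if a \<in> A then D - 1 else D)" by (intro prod.cong) auto
  also have "\<dots> = (D - 1) ^ m * D ^ (N - m)"
  proof -
    have "{..<N} \<inter> - A = {..<N} - A" by blast
    moreover have "{..<N} \<inter> A = A" using AN by blast
    ultimately show ?thesis
      using cA card_Diff_subset[OF fA AN] by (simp add: prod.If_cases)
  qed
  finally have "real (card B1) = (real D - 1) ^ m * real D ^ (N - m)"
    using D by (simp add: of_nat_diff)
  also have "\<dots> = (1 - 1 / D) ^ m * real D ^ N"
  proof -
    have "(1 - 1 / real D) ^ m * real D ^ m = (real D - 1) ^ m"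
      using D by (simp flip: power_mult_distrib add: field_simps)
    moreover have "real D ^ N = real D ^ m * real D ^ (N - m)" using mN by (simp flip: power_add)
    ultimately show ?thesis by (metis mult.assoc)
  qed
  finally have c1: "real (card B1) = (1 - 1 / D) ^ m * real D ^ N" .
  have maxA: "Max A < N" using Max_in[OF fA] AN cA m by fastforce
  have "B2 = PiE {..<N} (\<lambda>a. if a = Max A then {0} else {..<D})"
  proof (rule set_eqI)
    fix c
    have "c i \<in> (if i = Max A then {0} else {..<D}) \<longleftrightarrow> c i \<in> {..<D} \<and> (i = Max A \<longrightarrow> c i = 0)" for i
      using D by auto
    then show "c \<in> B2 \<longleftrightarrow> c \<in> PiE {..<N} (\<lambda>a. if a = Max A then {0} else {..<D})"
      using maxA unfolding B2_def mem_Collect_eq PiE_iff by (metis lessThan_iff)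
  qed
  then have "card B2 = (\<Prod>a<N. card (if a = Max A then {0} else {..<D}))" by (simp add: card_PiE)
  also have "\<dots> = (\<Prod>a<N. if a = Max A then 1 else D)" by (intro prod.cong) auto
  also have "\<dots> = D ^ (N - 1)"
  proof -
    have "{..<N} \<inter> {a. a = Max A} = {Max A}" "{..<N} \<inter> - {a. a = Max A} = {..<N} - {Max A}"
      using maxA by auto
    then show ?thesis using maxA by (simp add: prod.If_cases)
  qed
  finally have c2: "real (card B2) = 1 / D * real D ^ N"
    using D maxA power_Suc[of "real D" "N - 1"] by (simp add: field_simps)
  \<comment> \<open>The gap determines the forbidden phase; the outer \<open>mod\<close> covers gaps
    divisible by \<open>k\<close>.\<close>
  have "B3 \<subseteq> (\<lambda>c. (c, (k - gap c A mod k) mod k)) ` ?C"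
  proof
    fix x assume "x \<in> B3"
    then obtain c s where x: "x = (c, s)" "c \<in> ?C" "s < k" "(gap c A + s) mod k = 0"
      by (auto simp: B3_def \<Omega>_def)
    let ?g = "gap c A mod k"
    have g: "?g < k" using k by simp
    have "(?g + s) mod k = 0" using x(4) by (simp add: mod_add_left_eq)
    then have "k dvd ?g + s" by auto
    then obtain u where u: "?g + s = k * u" by blast
    have "k * u < k * 2" unfolding u[symmetric] using g x(3) by linarith
    then have "u < 2" using k by simp
    then have "u = 0 \<or> u = 1" by auto
    then have "s = (k - ?g) mod k" using u g x(3) by auto
    then show "x \<in> (\<lambda>c. (c, (k - gap c A mod k) mod k)) ` ?C" using x by auto
  qed
  then have c3: "card B3 \<le> D ^ N"
    using surj_card_le[OF finC] cardC by simp
  have "{\<omega> \<in> \<Omega>. \<not> good k (fst \<omega>) (snd \<omega>) A} \<subseteq> B1 \<times> {..<k} \<union> B2 \<times> {..<k} \<union> B3"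
  proof
    fix x assume "x \<in> {\<omega> \<in> \<Omega>. \<not> good k (fst \<omega>) (snd \<omega>) A}"
    then obtain c s where x: "x = (c, s)" and c: "c \<in> ?C" and s: "s \<in> {..<k}"
      and bad: "\<not> good k c s A"
      unfolding \<Omega>_def by (cases x) simp
    from bad consider "\<forall>a\<in>A. c a \<noteq> 0" | "c (Max A) = 0" | "(gap c A + s) mod k = 0"
      unfolding good_def by metis
    then show "x \<in> B1 \<times> {..<k} \<union> B2 \<times> {..<k} \<union> B3"
      by cases (use c s in \<open>simp_all add: x B1_def B2_def B3_def \<Omega>_def\<close>)
  qed
  moreover have "finite (B1 \<times> {..<k} \<union> B2 \<times> {..<k} \<union> B3)"
  proof (rule finite_subset)
    show "B1 \<times> {..<k} \<union> B2 \<times> {..<k} \<union> B3 \<subseteq> ?C \<times> {..<k}"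
      unfolding B1_def B2_def B3_def \<Omega>_def by (intro Un_least Sigma_mono) auto
    show "finite (?C \<times> {..<k})" using finC by simp
  qed
  ultimately have "card {\<omega> \<in> \<Omega>. \<not> good k (fst \<omega>) (snd \<omega>) A} \<le> card (B1 \<times> {..<k} \<union> B2 \<times> {..<k} \<union> B3)"
    by (rule card_mono[rotated])
  also have "\<dots> \<le> card (B1 \<times> {..<k}) + card (B2 \<times> {..<k}) + card B3"
    by (meson card_Un_le add_right_mono order_trans)
  also have "\<dots> \<le> card B1 * k + card B2 * k + D ^ N" using c3 by (simp add: card_cartesian_product)
  finally have "real (card {\<omega> \<in> \<Omega>. \<not> good k (fst \<omega>) (snd \<omega>) A}) \<le> real (card B1 * k + card B2 * k + D ^ N)"
    by (rule of_nat_mono)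
  also have "\<dots> = real (card B1) * k + real (card B2) * k + real D ^ N" by simp
  also have "\<dots> = ((1 - 1 / D) ^ m + 1 / D + 1 / k) * card \<Omega>"
    using k by (simp add: c1 c2 \<Omega>_def card_cartesian_product cardC field_simps)
  finally show ?thesis .
qed

section \<open>Colouring versus density in the cube\<close>

text \<open>The moving coordinates are those acting as the identity along \<open>e\<close>; all
  others are constant. There is a moving one, since otherwise no coordinate would separate
  \<open>e 1\<close> from \<open>e 2\<close>.\<close>

lemma (in line_system) comb_line_of_edge:
  assumes e: "e \<in> E" and k: "k \<ge> 2" and sep: "separating F X"
    and n: "F = h ` {0..<n}"
  shows "comb_line k n ((\<lambda>x. restrict (\<lambda>j. h j x) {0..<n}) ` e ` {1..k})"
  unfolding comb_line_def
proof (intro exI conjI)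
  let ?M = "{j \<in> {0..<n}. \<forall>i\<in>{1..k}. h j (e i) = i}"
  let ?u = "\<lambda>j. h j (e 1)"
  have one: "1 \<in> {1..k}" "2 \<in> {1..k}" using k by auto
  show "?M \<subseteq> {0..<n}" by blast
  have const: "h j (e i) = ?u j" if "j \<in> {0..<n}" "j \<notin> ?M" "i \<in> {1..k}" for i j
    using edge_line[OF e, of "h j"] that one n unfolding const_or_id_def by fastforce
  show "?M \<noteq> {}"
  proof
    assume "?M = {}"
    then have eq: "h j (e 1) = h j (e 2)" if "j \<in> {0..<n}" for j
      using const[OF that _ one(2)] by simp
    have "e 1 = e 2"
      by (rule separatingD[OF sep edge_in[OF e one(1)] edge_in[OF e one(2)]]) (use n eq in auto)
    then show False using inj_onD[OF edge_inj[OF e], of 1 2] one by simp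
  qed
  show "\<forall>c\<in>{0..<n} - ?M. ?u c \<in> {1..k}"
    using coord_range edge_in[OF e one(1)] n by blast
  show "(\<lambda>x. restrict (\<lambda>j. h j x) {0..<n}) ` e ` {1..k} =
      (\<lambda>i. restrict (\<lambda>c. if c \<in> ?M then i else ?u c) {0..<n}) ` {1..k}"
    unfolding image_image
  proof (intro image_cong refl restrict_ext)
    fix i j assume "i \<in> {1..k}" "j \<in> {0..<n}"
    then show "h j (e i) = (if j \<in> ?M then i else ?u j)" using const[of j i] by auto
  qed
qed

text \<open>Double counting of bad pairs: if every \<open>\<omega>\<close> failed, there would be
  more of them than the bounds for the single \<open>y\<close> allow.\<close>

lemma averaging:
  fixes \<Omega> :: "'w set" and Y :: "'y set" and \<epsilon> :: real
  assumes fin: "finite \<Omega>" "\<Omega> \<noteq> {}" "finite Y"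
    and P: "\<And>y. y \<in> Y \<Longrightarrow> real (card {\<omega> \<in> \<Omega>. \<not> P \<omega> y}) \<le> \<epsilon> * card \<Omega>"
  shows "\<exists>\<omega>\<in>\<Omega>. real (card {y \<in> Y. P \<omega> y}) \<ge> (1 - \<epsilon>) * card Y"
proof (rule ccontr)
  assume "\<not> ?thesis"
  then have lt: "real (card {y \<in> Y. P \<omega> y}) < (1 - \<epsilon>) * card Y" if "\<omega> \<in> \<Omega>" for \<omega>
    using that by force
  have eq: "card {y \<in> Y. P \<omega> y} + card {y \<in> Y. \<not> P \<omega> y} = card Y" for \<omega>
  proof -
    have "Y = {y \<in> Y. P \<omega> y} \<union> {y \<in> Y. \<not> P \<omega> y}" by blast
    then show ?thesis using fin(3) by (subst card_Un_disjoint[symmetric]) auto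
  qed
  have "\<epsilon> * card Y < real (card {y \<in> Y. \<not> P \<omega> y})" if "\<omega> \<in> \<Omega>" for \<omega>
    using lt[OF that] eq[of \<omega>, THEN arg_cong[of _ _ real]] by (simp add: algebra_simps)
  then have "(\<Sum>\<omega>\<in>\<Omega>. \<epsilon> * card Y) < (\<Sum>\<omega>\<in>\<Omega>. real (card {y \<in> Y. \<not> P \<omega> y}))"
    using fin by (intro sum_strict_mono) auto
  also have "\<dots> = real (\<Sum>y\<in>Y. card {\<omega> \<in> \<Omega>. \<not> P \<omega> y})"
    using sum_multicount_gen[OF fin(1,3), of "\<lambda>\<omega> y. \<not> P \<omega> y" "\<lambda>y. card {\<omega> \<in> \<Omega>. \<not> P \<omega> y}"]
    by (simp flip: of_nat_sum)
  also have "\<dots> \<le> (\<Sum>y\<in>Y. \<epsilon> * card \<Omega>)"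
    using P by (simp only: of_nat_sum) (rule sum_mono)
  finally show False by simp
qed

theorem theorem1p7:
  fixes k r :: nat and \<mu> :: real
  assumes "k \<ge> 3" and "r \<ge> 1" and "0 < \<mu>" and "\<mu> < (real k - 1) / real k"
  shows "\<exists>n. \<exists>X \<subseteq> cube k n.
     (\<forall>f :: (nat \<Rightarrow> nat) \<Rightarrow> nat. f ` X \<subseteq> {..<r} \<longrightarrow>
        (\<exists>L. comb_line k n L \<and> L \<subseteq> X \<and> (\<exists>c. \<forall>x\<in>L. f x = c))) \<and>
     (\<forall>Y \<subseteq> X. \<exists>Z \<subseteq> Y. real (card Z) \<ge> \<mu> * real (card Y) \<and>
        \<not> (\<exists>L \<subseteq> Z. quasiline k n L))"
proof -
  \<comment> \<open>Half of this slack pays for markers at the end of a window, half for windows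
    without a marker.\<close>
  define \<delta> where "\<delta> = 1 - 1 / real k - \<mu>"
  have \<delta>: "\<delta> > 0" using assms by (simp add: \<delta>_def field_simps)
  obtain D' where D': "1 / real (Suc D') < \<delta> / 2"
    using nat_approx_posE[of "\<delta> / 2"] \<delta> by auto
  define D where "D = Suc D'"
  have D: "D \<ge> 1" "1 / real D < \<delta> / 2" using D' by (auto simp: D_def)
  obtain m' where "(1 - 1 / real D) ^ m' < \<delta> / 2"
    using real_arch_pow_inv[of "\<delta> / 2" "1 - 1 / real D"] \<delta> D(1) by auto
  \<comment> \<open>Raising the exponent by one guarantees that \<open>m\<close> is
    positive.\<close>
  moreover have "(1 - 1 / real D) ^ Suc m' \<le> (1 - 1 / real D) ^ m'"
    using D(1) by (intro power_decreasing) auto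
  ultimately have "(1 - 1 / real D) ^ Suc m' < \<delta> / 2" by linarith
  then obtain m where m: "m \<ge> 1" "(1 - 1 / real D) ^ m < \<delta> / 2"
    by (rule that[rotated]) simp
  define \<epsilon> where "\<epsilon> = (1 - 1 / real D) ^ m + 1 / real D + 1 / real k"
  have \<mu>: "\<mu> \<le> 1 - \<epsilon>" using m(2) D(2) by (simp add: \<epsilon>_def \<delta>_def)

  obtain N where ram0: "ramsey k r (nsets {..<N} m) (window_edges k m N)"
    using ramsey_windows by blast
  \<comment> \<open>The first pass supplies the coordinates \<open>F1\<close>, which windows
    lack.\<close>
  interpret H0: base_system k "nsets {..<N} m" "{}" "window_edges k m N" r
    using line_system_windows[OF m(1)] assms by (simp add: base_system_def base_system_axioms_def)
  obtain X1 :: "nat set" and F1 \<Lambda>1 p1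
    where pic1: "H0.picture X1 F1 \<Lambda>1 p1" and ram1: "ramsey k r X1 \<Lambda>1"
    using H0.partite_construction[OF ram0] by blast
  have sys1: "line_system k X1 F1 \<Lambda>1" and sep1: "separating F1 X1"
    and p1: "p1 ` X1 \<subseteq> nsets {..<N} m"
    and proj1: "\<And>l. l \<in> \<Lambda>1 \<Longrightarrow> \<exists>e\<in>window_edges k m N. \<forall>i\<in>{1..k}. p1 (l i) = e i"
    using pic1 unfolding H0.picture_def by auto
  \<comment> \<open>Since \<open>F1\<close> separates \<open>X1\<close>, the quasiline clause of
    \<open>picture\<close> takes effect in the second pass.\<close>
  interpret H1: base_system k X1 F1 \<Lambda>1 r
    using sys1 assms by (simp add: base_system_def base_system_axioms_def)
  obtain X2 :: "nat set" and F2 \<Lambda>2 p2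
    where pic2: "H1.picture X2 F2 \<Lambda>2 p2" and ram2: "ramsey k r X2 \<Lambda>2"
    using H1.partite_construction[OF ram1] by blast
  have sys2: "line_system k X2 F2 \<Lambda>2" and sep2: "separating F2 X2" and p2: "p2 ` X2 \<subseteq> X1"
    and quasi2: "\<And>L. L \<subseteq> X2 \<Longrightarrow> abs_quasiline k F2 L \<Longrightarrow> \<exists>l\<in>\<Lambda>1. p2 ` L = l ` {1..k}"
    using pic2 sep1 unfolding H1.picture_def by auto
  interpret S2: line_system k X2 F2 \<Lambda>2 by (rule sys2)
  define \<pi> where "\<pi> x = p1 (p2 x)" for x
  have \<pi>_in: "\<pi> x \<in> nsets {..<N} m" if "x \<in> X2" for x
    using that p1 p2 by (auto simp: \<pi>_def)
  have quasi_\<pi>: "\<exists>e\<in>window_edges k m N. \<pi> ` L = e ` {1..k}"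
    if L: "L \<subseteq> X2" "abs_quasiline k F2 L" for L
  proof -
    obtain l where l: "l \<in> \<Lambda>1" "p2 ` L = l ` {1..k}" using quasi2[OF L] by blast
    obtain e where e: "e \<in> window_edges k m N" "\<forall>i\<in>{1..k}. p1 (l i) = e i" using proj1[OF l(1)] by blast
    have "\<pi> ` L = p1 ` p2 ` L" by (simp add: \<pi>_def image_image)
    also have "\<dots> = e ` {1..k}" unfolding l(2) image_image using e(2) by (intro image_cong) auto
    finally show ?thesis by (rule bexI[OF _ e(1)])
  qed

  define n where "n = card F2"
  obtain h where h: "bij_betw h {0..<n} F2"
    using ex_bij_betw_nat_finite[OF S2.finite_coords] unfolding n_def by blast
  have F2h: "F2 = h ` {0..<n}" using h by (simp add: bij_betw_def)
  \<comment> \<open>Evaluating the enumerated coordinate functions embeds the abstract points into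
    the cube; it is injective by separation.\<close>
  define \<iota> where "\<iota> x = restrict (\<lambda>j. h j x) {0..<n}" for x
  have \<iota>_h: "\<iota> x j = h j x" if "j \<in> {0..<n}" for x j using that by (simp add: \<iota>_def)
  have \<iota>_inj: "inj_on \<iota> X2"
  proof (rule inj_onI)
    fix x y assume x: "x \<in> X2" and y: "y \<in> X2" and eq: "\<iota> x = \<iota> y"
    show "x = y"
    proof (rule separatingD[OF sep2 x y])
      fix f assume "f \<in> F2"
      then obtain j where "j \<in> {0..<n}" "f = h j" using F2h by blast
      then show "f x = f y" using \<iota>_h[of j x] \<iota>_h[of j y] eq by simp
    qed
  qed
  define X where "X = \<iota> ` X2"
  have "X \<subseteq> cube k n"
    unfolding X_def cube_def \<iota>_def using S2.coord_range F2h by (auto intro!: restrict_PiE_iff[THEN iffD2])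
  moreover have "\<exists>L. comb_line k n L \<and> L \<subseteq> X \<and> (\<exists>c. \<forall>x\<in>L. f x = c)"
    if f: "f ` X \<subseteq> {..<r}" for f :: "(nat \<Rightarrow> nat) \<Rightarrow> nat"
  proof -
    have "(\<lambda>x. f (\<iota> x)) ` X2 \<subseteq> {..<r}" using f by (auto simp: X_def)
    then obtain l q where l: "l \<in> \<Lambda>2" "\<forall>i\<in>{1..k}. f (\<iota> (l i)) = q"
      using ram2[unfolded ramsey_def, rule_format, of "\<lambda>x. f (\<iota> x)"] by blast
    have "comb_line k n (\<iota> ` l ` {1..k})"
      using S2.comb_line_of_edge[OF l(1) _ sep2 F2h] assms(1) unfolding \<iota>_def by simp
    moreover have "\<iota> ` l ` {1..k} \<subseteq> X" using S2.edge_in[OF l(1)] by (auto simp: X_def)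
    moreover have "\<forall>x\<in>\<iota> ` l ` {1..k}. f x = q" using l(2) by blast
    ultimately show ?thesis by blast
  qed
  moreover have "\<exists>Z \<subseteq> Y. real (card Z) \<ge> \<mu> * real (card Y) \<and> \<not> (\<exists>L \<subseteq> Z. quasiline k n L)"
    if Y: "Y \<subseteq> X" for Y
  proof -
    define Y2 where "Y2 = {x \<in> X2. \<iota> x \<in> Y}"
    have Y2: "Y2 \<subseteq> X2" "\<iota> ` Y2 = Y" using Y by (auto simp: Y2_def X_def)
    have inj: "inj_on \<iota> B" if "B \<subseteq> X2" for B using \<iota>_inj that by (rule inj_on_subset)
    let ?\<Omega> = "({..<N} \<rightarrow>\<^sub>E {..<D}) \<times> {..<k}"
    have "(restrict (\<lambda>_. 0) {..<N}, 0) \<in> ?\<Omega>" using D(1) assms(1) by auto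
    then have ne: "?\<Omega> \<noteq> {}" by blast
    have fin: "finite ?\<Omega>" by (simp add: finite_PiE)
    have finY: "finite Y2" using Y2(1) S2.finite_points by (rule finite_subset)
    have bad: "real (card {\<omega> \<in> ?\<Omega>. \<not> good k (fst \<omega>) (snd \<omega>) (\<pi> y)}) \<le> \<epsilon> * card ?\<Omega>" if "y \<in> Y2" for y
      unfolding \<epsilon>_def using that Y2(1) assms(1) by (intro card_bad_le[OF \<pi>_in m(1) D(1)]) auto
    \<comment> \<open>The bound \<open>bad\<close> holds for each single point, so averaging works
      for any \<open>Y\<close>; the choice of \<open>\<omega>\<close> depends on
      \<open>Y\<close>.\<close>
    have "\<exists>\<omega>\<in>?\<Omega>. (1 - \<epsilon>) * card Y2 \<le> real (card {y \<in> Y2. good k (fst \<omega>) (snd \<omega>) (\<pi> y)})"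
      by (rule averaging[OF fin ne finY bad])
    then obtain \<omega> where \<omega>: "(1 - \<epsilon>) * card Y2 \<le> real (card {y \<in> Y2. good k (fst \<omega>) (snd \<omega>) (\<pi> y)})"
      by (elim bexE)
    define Z2 where "Z2 = {y \<in> Y2. good k (fst \<omega>) (snd \<omega>) (\<pi> y)}"
    have Z2: "Z2 \<subseteq> X2" using Y2 by (auto simp: Z2_def)
    have "\<mu> * card Y2 \<le> (1 - \<epsilon>) * card Y2" using \<mu> by (intro mult_right_mono) auto
    also have "\<dots> \<le> card Z2" using \<omega> by (simp add: Z2_def)
    finally have "\<mu> * real (card Y) \<le> real (card (\<iota> ` Z2))"
      using card_image[OF inj[OF Y2(1)]] card_image[OF inj[OF Z2]] Y2(2) by simp
    moreover have "\<iota> ` Z2 \<subseteq> Y" using Y2(2) by (auto simp: Z2_def)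
    \<comment> \<open>A quasiline among the kept points would project onto a window edge with only
      good windows.\<close>
    moreover have "\<not> quasiline k n L" if L: "L \<subseteq> \<iota> ` Z2" for L
    proof
      assume ql: "quasiline k n L"
      obtain L2 where L2: "L2 \<subseteq> Z2" "L = \<iota> ` L2" using L by (auto simp: subset_image_iff)
      have injL: "inj_on \<iota> L2" using L2(1) Z2 by (intro inj) blast
      have "abs_quasiline k F2 L2"
        unfolding abs_quasiline_def
      proof (intro conjI ballI)
        show "card L2 = k" using ql card_image[OF injL] L2(2) by (simp add: quasiline_def)
        fix f assume "f \<in> F2"
        then obtain j where j: "j \<in> {0..<n}" "f = h j" using F2h by blast
        have "(\<forall>x\<in>L. \<forall>y\<in>L. x j = y j) \<or> inj_on (\<lambda>x. x j) L"
          using ql j(1) unfolding quasiline_def by blast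
        then show "(\<forall>x\<in>L2. \<forall>y\<in>L2. f x = f y) \<or> inj_on f L2"
        proof
          assume "\<forall>x\<in>L. \<forall>y\<in>L. x j = y j"
          then have "\<forall>x\<in>L2. \<forall>y\<in>L2. \<iota> x j = \<iota> y j" unfolding L2(2) by blast
          then show ?thesis unfolding \<iota>_h[OF j(1)] j(2) by (rule disjI1)
        next
          assume "inj_on (\<lambda>x. x j) L"
          then have "inj_on (\<lambda>x. \<iota> x j) L2"
            using comp_inj_on[OF injL, of "\<lambda>x. x j"] unfolding L2(2) o_def by simp
          then show ?thesis unfolding \<iota>_h[OF j(1)] j(2) by (rule disjI2)
        qed
      qed
      then obtain e where e: "e \<in> window_edges k m N" "\<pi> ` L2 = e ` {1..k}"
        using quasi_\<pi>[of L2] L2(1) Z2 by blast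
      obtain i where i: "i \<in> {1..k}" "\<not> good k (fst \<omega>) (snd \<omega>) (e i)"
        using window_not_all_good[OF _ m(1) e(1)] assms(1) by force
      have "e i \<in> \<pi> ` L2" unfolding e(2) using i(1) by blast
      then show False using i(2) L2(1) by (auto simp: Z2_def)
    qed
    ultimately show ?thesis by blast
  qed
  ultimately show ?thesis by blast
qed

end
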